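(* Let $f,g_1,\dots,g_m\in\mathbb{R}[\mathbf{x}]$, $d_0=\deg f$, let $\mathbf{K}=\{\mathbf{x}\in\mathbb{R}^n: g_j(\mathbf{x})\ge 0,\ j=1,\dots,m\}$ have nonempty interior and assume $0\in\mathbf{K}$. Let $\mathbf{x}^*\in\mathbf{K}$ be a global minimizer of the problem $\mathbf{P}:\ f^*=\min\{f(\mathbf{x}):\mathbf{x}\in\mathbf{K}\}$ with optimal value $f^*$. Let $d\in\mathbb{N}$, $k\in\{1,2,\infty\}$, and let $\tilde f_d\in\mathbb{R}[\mathbf{x}]_{d_0}$ be an optimal solution of $$\mathbf{P}_d:\quad \rho_d^k:=\min_{\tilde f,\sigma_j}\Big\{\|f-\tilde f\|_k:\ \tilde f(\mathbf{x})-\tilde f(0)=\sum_{j=0}^m\sigma_j(\mathbf{x})g_j(\mathbf{x})\ \ \forall \mathbf{x}\in\mathbb{R}^n;\ \tilde f\in\mathbb{R}[\mathbf{x}]_{d_0};\ \sigma_j\in\Sigma[\mathbf{x}]_{d-v_j},\ j=0,\dots,m\Big\},$$ with optimal value $\rho_d^k$. Then: (a) $0\in\mathbf{K}$ is a global minimizer of the problem $\min_{\mathbf{x}}\{\tilde f_d(\mathbf{x}):\mathbf{x}\in\mathbf{K}\}$. In particular, if $\rho_d^k=0$ then $\tilde f_d=f$ and $0$ is a global minimizer of $\mathbf{P}$. (b) If $k=1$ then $f^*\le f(0)\le f^*+\rho_d^1\,\sup_{\alpha\in\mathbb{N}^n_{d_0}}|(\mathbf{x}^* )^\alpha|$. In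 particular, if $\mathbf{K}\subseteq[-1,1]^n$ then $f^*\le f(0)\le f^*+\rho_d^1$. (c) If $k=\infty$ then $f^*\le f(0)\le f^*+\rho_d^\infty\sum_{\alpha\in\mathbb{N}^n_{d_0}}|(\mathbf{x}^* )^\alpha|$. In particular, if $\mathbf{K}\subseteq[-1,1]^n$ then $f^*\le f(0)\le f^*+s(d_0)\,\rho_d^\infty$.
   Context: $\mathbb{R}[\mathbf{x}]$ is the ring of real polynomials in $\mathbf{x}=(x_1,\dots,x_n)$ and $\mathbb{R}[\mathbf{x}]_d$ the subspace of polynomials of degree at most $d$. $\Sigma[\mathbf{x}]$ is the set of sums of squares of polynomials, and $\Sigma[\mathbf{x}]_r$ the set of sums of squares of degree at most $2r$ (so $\{0\}$ if $r<0$). $\mathbb{N}^n_d=\{\alpha\in\mathbb{N}^n:\sum_i\alpha_i\le d\}$, $s(d)=\binom{n+d}{n}$, and $\mathbf{x}^\alpha=x_1^{\alpha_1}\cdots x_n^{\alpha_n}$. For $h=\sum_\alpha h_\alpha\mathbf{x}^\alpha$: $\|h\|_1=\sum_\alpha|h_\alpha|$, $\|h\|_2=\sum_\alpha h_\alpha^2$ (sum of squares, no square root), $\|h\|_\infty=\max_\alpha|h_\alpha|$. By convention $g_0\equiv1$ and $v_j=\lceil(\deg g_j)/2\rceil$ for $j=0,\dots,m$ (so $v_0=0$). The given feasible point $\mathbf{y}\in\mathbf{K}$ of the inverse problem is assumed, after translation, to be $\mathbf{y}=0$. *)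

theory Defs
  imports "HOL-Analysis.Analysis" "HOL-Library.Poly_Mapping" "HOL-Library.Extended_Nat"
begin

text \<open>
  Real polynomials in the variables indexed by the finite type \<open>'n\<close> (so n is \<open>CARD('n)\<close>) are
  finitely supported maps from exponent vectors to coefficients; addition and multiplication
  are those of \<^theory>\<open>HOL-Library.Poly_Mapping\<close> (multiplication is convolution).
\<close>

type_synonym 'n expo = "'n \<Rightarrow>\<^sub>0 nat"
type_synonym 'n rpoly = "'n expo \<Rightarrow>\<^sub>0 real"

definition total_exp :: "'n::finite expo \<Rightarrow> nat"
  where "total_exp \<alpha> = (\<Sum>i\<in>UNIV. Poly_Mapping.lookup \<alpha> i)"

definition expos_upto :: "nat \<Rightarrow> 'n::finite expo set"
  where "expos_upto d = {\<alpha>. total_exp \<alpha> \<le> d}"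

definition monom_eval :: "'n::finite expo \<Rightarrow> real ^ 'n \<Rightarrow> real"
  where "monom_eval \<alpha> x = (\<Prod>i\<in>UNIV. (x $ i) ^ Poly_Mapping.lookup \<alpha> i)"

definition rpoly_eval :: "'n::finite rpoly \<Rightarrow> real ^ 'n \<Rightarrow> real"
  where "rpoly_eval p x = (\<Sum>\<alpha>\<in>Poly_Mapping.keys p. Poly_Mapping.lookup p \<alpha> * monom_eval \<alpha> x)"

text \<open>The zero polynomial gets degree 0.\<close>

definition rdegree :: "'n::finite rpoly \<Rightarrow> nat"
  where "rdegree p = Max (insert 0 (total_exp ` Poly_Mapping.keys p))"

definition rpolys_upto :: "nat \<Rightarrow> 'n::finite rpoly set"
  where "rpolys_upto d = {p. rdegree p \<le> d}"

definition sos :: "'n::finite rpoly set"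
  where "sos = {p. \<exists>qs. p = (\<Sum>q\<leftarrow>qs. q\<^sup>2)}"

text \<open>
  The index is an integer because it will be a difference that may be negative; the disjunct
  \<open>p = 0\<close> makes the set \<open>{0}\<close> in that case.
\<close>

definition sos_upto :: "int \<Rightarrow> 'n::finite rpoly set"
  where "sos_upto r = {p \<in> sos. p = 0 \<or> int (rdegree p) \<le> 2 * r}"

text \<open>
  Only the indices 1, 2 and \<open>\<infinity>\<close> are meant. For index 2 there is deliberately no square root.
  In the last case the maximum is over all exponent vectors; only finitely many values occur.
\<close>

definition coeff_norm :: "enat \<Rightarrow> 'n::finite rpoly \<Rightarrow> real"
  where "coeff_norm k h =
    (if k = 1 then (\<Sum>\<alpha>\<in>Poly_Mapping.keys h. \<bar>Poly_Mapping.lookup h \<alpha>\<bar>)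
     else if k = 2 then (\<Sum>\<alpha>\<in>Poly_Mapping.keys h. (Poly_Mapping.lookup h \<alpha>)\<^sup>2)
     else (MAX \<alpha>. \<bar>Poly_Mapping.lookup h \<alpha>\<bar>))"

text \<open>The given constraints are \<open>g 1, \<dots>, g m\<close>; the value of \<open>g\<close> at 0 is replaced by 1.\<close>

definition with_one :: "(nat \<Rightarrow> 'n::finite rpoly) \<Rightarrow> nat \<Rightarrow> 'n rpoly"
  where "with_one g j = (if j = 0 then 1 else g j)"

definition semialg_set :: "nat \<Rightarrow> (nat \<Rightarrow> 'n::finite rpoly) \<Rightarrow> (real ^ 'n) set"
  where "semialg_set m g = {x. \<forall>j\<in>{1..m}. rpoly_eval (g j) x \<ge> 0}"

definition half_degree :: "'n::finite rpoly \<Rightarrow> int"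
  where "half_degree p = \<lceil>real (rdegree p) / 2\<rceil>"

text \<open>Feasible pairs of the problem \<open>P\<^sub>d\<close>: the perturbed objective and its multipliers.\<close>

definition inv_feasible ::
    "'n::finite rpoly \<Rightarrow> nat \<Rightarrow> (nat \<Rightarrow> 'n rpoly) \<Rightarrow> nat \<Rightarrow> ('n rpoly \<times> (nat \<Rightarrow> 'n rpoly)) set"
  where "inv_feasible f m g d =
    {(h, \<sigma>). (\<forall>x. rpoly_eval h x - rpoly_eval h 0 =
                  (\<Sum>j=0..m. rpoly_eval (\<sigma> j) x * rpoly_eval (with_one g j) x)) \<and>
             h \<in> rpolys_upto (rdegree f) \<and>
             (\<forall>j\<in>{0..m}. \<sigma> j \<in> sos_upto (int d - half_degree (with_one g j)))}"

definition inv_objective ::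
    "enat \<Rightarrow> 'n::finite rpoly \<Rightarrow> 'n rpoly \<times> (nat \<Rightarrow> 'n rpoly) \<Rightarrow> real"
  where "inv_objective k f = (\<lambda>(h, \<sigma>). coeff_norm k (f - h))"

definition inv_optimal_solution ::
    "enat \<Rightarrow> 'n::finite rpoly \<Rightarrow> nat \<Rightarrow> (nat \<Rightarrow> 'n rpoly) \<Rightarrow> nat \<Rightarrow> 'n rpoly \<Rightarrow> bool"
  where "inv_optimal_solution k f m g d h \<longleftrightarrow>
    (\<exists>\<sigma>. is_arg_min (inv_objective k f) (\<lambda>p. p \<in> inv_feasible f m g d) (h, \<sigma>))"

definition inv_value ::
    "enat \<Rightarrow> 'n::finite rpoly \<Rightarrow> nat \<Rightarrow> (nat \<Rightarrow> 'n rpoly) \<Rightarrow> nat \<Rightarrow> real"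
  where "inv_value k f m g d = (INF p\<in>inv_feasible f m g d. inv_objective k f p)"

abbreviation global_minimizer :: "'n::finite rpoly \<Rightarrow> (real ^ 'n) set \<Rightarrow> real ^ 'n \<Rightarrow> bool"
  where "global_minimizer f K x \<equiv> is_arg_min (rpoly_eval f) (\<lambda>y. y \<in> K) x"

end

theory Submission
  imports Defs
begin

text \<open>
  The point 0 lies in K, and the feasible certificate
  \<open>h - h(0) = \<sigma>\<^sub>0 + \<sigma>\<^sub>1 g\<^sub>1 + \<dots> + \<sigma>\<^sub>m g\<^sub>m\<close> is a sum of products of nonnegative
  numbers at every point of K. So it forces \<open>h(0) \<le> h(x)\<close> there (lemma
  \<open>inv_feasible_minimizer_0\<close>): 0 minimizes every feasible h on K. If the
  distance between f and the optimal h is 0, all coefficients of \<open>f - h\<close> vanish,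
  so h is f and 0 minimizes f on K.

  For the bounds, put \<open>e = f - h\<close> with h optimal and let \<open>x\<^sup>*\<close> be the given minimizer. Then
  \<open>f(0) - f(x\<^sup>*) = (e(0) - e(x\<^sup>*)) + (h(0) - h(x\<^sup>*)) \<le> e(0) - e(x\<^sup>*)\<close>. The constant term of e cancels in
  this difference and the other monomials vanish at 0, so the difference is at most
  \<open>\<Sum>\<^sub>\<alpha> \<bar>e\<^sub>\<alpha>\<bar> \<bar>(x\<^sup>*)\<^sup>\<alpha>\<bar>\<close>, the sum running over the exponents of degree at most \<open>deg f\<close> (lemma
  \<open>rpoly_eval_0_diff_le\<close>). The two bounds are the two ways to apply Hoelder's inequality to this sum.
  On the unit cube every monomial is at most 1 in absolute value, and there are
  \<open>(n + d\<^sub>0) choose n\<close> exponents of degree at most \<open>d\<^sub>0\<close>.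
\<close>

section \<open>Evaluation of polynomials\<close>

lemma monom_eval_zero: "monom_eval 0 x = 1"
  by (simp add: monom_eval_def)

lemma monom_eval_add: "monom_eval (\<alpha> + \<beta>) x = monom_eval \<alpha> x * monom_eval \<beta> x"
  by (simp add: monom_eval_def lookup_add power_add prod.distrib)

lemma monom_eval_at_0:
  assumes "\<alpha> \<noteq> 0"
  shows "monom_eval \<alpha> 0 = 0"
proof -
  obtain i where "Poly_Mapping.lookup \<alpha> i \<noteq> 0"
    using assms by (metis lookup_zero poly_mapping_eqI)
  then show ?thesis
    by (auto simp: monom_eval_def intro!: prod_zero bexI[of _ i])
qed

lemma monom_eval_abs_le_1:
  assumes "\<forall>i. x $ i \<in> {-1..1}"
  shows "\<bar>monom_eval \<alpha> x\<bar> \<le> 1"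
proof -
  have "\<bar>x $ i\<bar> \<le> 1" for i
    using assms by (auto simp: abs_le_iff minus_le_iff)
  then show ?thesis
    by (auto simp: monom_eval_def abs_prod power_abs intro!: prod_le_1 power_le_one)
qed

lemma rpoly_eval_superset:
  assumes "finite A" "Poly_Mapping.keys p \<subseteq> A"
  shows "rpoly_eval p x = (\<Sum>\<alpha>\<in>A. Poly_Mapping.lookup p \<alpha> * monom_eval \<alpha> x)"
  unfolding rpoly_eval_def
  using assms by (intro sum.mono_neutral_left) (auto simp: in_keys_iff)

lemma rpoly_eval_0: "rpoly_eval 0 x = 0"
  by (simp add: rpoly_eval_def)

lemma rpoly_eval_1: "rpoly_eval 1 x = 1"
  by (simp add: rpoly_eval_def monom_eval_zero lookup_one)

lemma rpoly_eval_single: "rpoly_eval (Poly_Mapping.single \<alpha> c) x = c * monom_eval \<alpha> x"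
  by (simp add: rpoly_eval_def)

lemma rpoly_eval_add: "rpoly_eval (p + q) x = rpoly_eval p x + rpoly_eval q x"
  unfolding rpoly_eval_def
  by (rule setsum_keys_plus_distrib) (auto simp: distrib_right)

lemma rpoly_eval_diff: "rpoly_eval (p - q) x = rpoly_eval p x - rpoly_eval q x"
  using rpoly_eval_add[of "p - q" q x] by simp

lemma rpoly_eval_sum: "rpoly_eval (\<Sum>i\<in>I. p i) x = (\<Sum>i\<in>I. rpoly_eval (p i) x)"
  by (induction I rule: infinite_finite_induct) (auto simp: rpoly_eval_0 rpoly_eval_add)

lemma poly_mapping_sum_singles:
  "p = (\<Sum>a\<in>Poly_Mapping.keys p. Poly_Mapping.single a (Poly_Mapping.lookup p a))"
  by (rule poly_mapping_eqI) (auto simp: lookup_sum lookup_single when_def in_keys_iff)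

text \<open>By bilinearity it is enough to treat single terms, where exponents add.\<close>

lemma rpoly_eval_mult: "rpoly_eval (p * q) x = rpoly_eval p x * rpoly_eval q x"
proof -
  have "p * q = (\<Sum>a\<in>Poly_Mapping.keys p. Poly_Mapping.single a (Poly_Mapping.lookup p a)) *
      (\<Sum>b\<in>Poly_Mapping.keys q. Poly_Mapping.single b (Poly_Mapping.lookup q b))"
    by (metis poly_mapping_sum_singles)
  also have "\<dots> = (\<Sum>a\<in>Poly_Mapping.keys p. \<Sum>b\<in>Poly_Mapping.keys q.
      Poly_Mapping.single (a + b) (Poly_Mapping.lookup p a * Poly_Mapping.lookup q b))"
    by (simp add: sum_product mult_single)
  finally show ?thesis
    by (simp add: rpoly_eval_sum rpoly_eval_single monom_eval_add)
      (simp add: rpoly_eval_def sum_product mult_ac)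
qed

lemma sos_eval_nonneg:
  assumes "p \<in> sos"
  shows "rpoly_eval p x \<ge> 0"
proof -
  have "rpoly_eval (\<Sum>q\<leftarrow>qs. q\<^sup>2) x \<ge> 0" for qs
    by (induction qs) (auto simp: rpoly_eval_0 rpoly_eval_add rpoly_eval_mult power2_eq_square)
  with assms show ?thesis
    by (auto simp: sos_def)
qed

section \<open>Exponents of bounded degree\<close>

text \<open>
  Listing the exponents of the variables in some order, preceded by the slack that completes
  the degree to \<open>d\<close>, maps into the lists of length \<open>n + 1\<close> with sum \<open>d\<close>, which stars and bars counts.
\<close>

lemma card_expos_upto:
  fixes d :: nat
  shows "finite (expos_upto d :: 'n::finite expo set)"
    and "card (expos_upto d :: 'n expo set) \<le> (CARD('n) + d) choose CARD('n)"
proof -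
  obtain xs :: "'n list" where xs: "set xs = UNIV" "distinct xs"
    using finite_distinct_list[OF finite] by metis
  have len: "length xs = CARD('n)"
    using xs distinct_card by fastforce
  have total: "total_exp \<alpha> = sum_list (map (Poly_Mapping.lookup \<alpha>) xs)" for \<alpha> :: "'n expo"
    using xs by (simp add: total_exp_def sum_list_distinct_conv_sum_set)
  define \<phi> where
    "\<phi> \<alpha> = (d - total_exp \<alpha>) # map (Poly_Mapping.lookup \<alpha>) xs" for \<alpha> :: "'n expo"
  define L where "L = {l :: nat list. length l = CARD('n) + 1 \<and> sum_list l = d}"
  have "card L = (d + CARD('n)) choose d"
    unfolding L_def by (subst card_length_sum_list) simp
  also have "\<dots> = (CARD('n) + d) choose CARD('n)"
    by (subst binomial_symmetric) (auto simp: add.commute)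
  finally have card_L: "card L = (CARD('n) + d) choose CARD('n)" .
  then have finite_L: "finite L"
    by (intro card_ge_0_finite) simp
  have "inj_on \<phi> (expos_upto d)"
  proof (rule inj_onI)
    fix \<alpha> \<beta> :: "'n expo"
    assume "\<phi> \<alpha> = \<phi> \<beta>"
    then have "\<forall>i\<in>set xs. Poly_Mapping.lookup \<alpha> i = Poly_Mapping.lookup \<beta> i"
      by (simp add: \<phi>_def)
    then show "\<alpha> = \<beta>"
      using xs by (intro poly_mapping_eqI) simp
  qed
  moreover have "\<phi> ` expos_upto d \<subseteq> L"
    by (auto simp: \<phi>_def L_def len expos_upto_def total[symmetric])
  ultimately show "finite (expos_upto d :: 'n expo set)"
    and "card (expos_upto d :: 'n expo set) \<le> (CARD('n) + d) choose CARD('n)"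
    using finite_L card_L by (metis inj_on_finite, metis card_inj_on_le)
qed

lemma zero_in_expos_upto: "0 \<in> expos_upto d"
  by (simp add: expos_upto_def total_exp_def)

lemma keys_subset_expos_upto_iff: "Poly_Mapping.keys p \<subseteq> expos_upto d \<longleftrightarrow> rdegree p \<le> d"
  by (auto simp: rdegree_def expos_upto_def)

section \<open>Coefficient norms\<close>

lemma coeff_norm_1_superset:
  assumes "finite A" "Poly_Mapping.keys h \<subseteq> A"
  shows "coeff_norm 1 h = (\<Sum>\<alpha>\<in>A. \<bar>Poly_Mapping.lookup h \<alpha>\<bar>)"
  using assms by (auto simp: coeff_norm_def in_keys_iff intro!: sum.mono_neutral_left)

text \<open>
  All but finitely many coefficients are 0, so the maximum is one over finitely many values.
\<close>

lemma coeff_le_coeff_norm_infinity: "\<bar>Poly_Mapping.lookup h \<alpha>\<bar> \<le> coeff_norm \<infinity> h"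
proof -
  have "range (\<lambda>\<alpha>. \<bar>Poly_Mapping.lookup h \<alpha>\<bar>) \<subseteq>
      insert 0 ((\<lambda>\<alpha>. \<bar>Poly_Mapping.lookup h \<alpha>\<bar>) ` Poly_Mapping.keys h)"
    by (auto simp: in_keys_iff image_iff)
  then have "finite (range (\<lambda>\<alpha>. \<bar>Poly_Mapping.lookup h \<alpha>\<bar>))"
    by (rule finite_subset) auto
  then show ?thesis
    by (auto simp: coeff_norm_def one_enat_def numeral_eq_enat intro!: Max_ge)
qed

lemma coeff_norm_nonneg:
  assumes "k \<in> {1, 2, \<infinity>}"
  shows "coeff_norm k h \<ge> 0"
proof (cases "k = \<infinity>")
  case True
  then show ?thesis
    using coeff_le_coeff_norm_infinity[of h 0] by (auto intro: order_trans[OF abs_ge_zero])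
next
  case False
  with assms show ?thesis
    by (auto simp: coeff_norm_def intro!: sum_nonneg)
qed

lemma coeff_norm_eq_0D:
  assumes "k \<in> {1, 2, \<infinity>}" "coeff_norm k h = 0"
  shows "h = 0"
proof (cases "k = \<infinity>")
  case True
  then show ?thesis
    using coeff_le_coeff_norm_infinity[of h] assms by (intro poly_mapping_eqI) auto
next
  case False
  have "Poly_Mapping.keys h = {}"
  proof (rule ccontr)
    assume "Poly_Mapping.keys h \<noteq> {}"
    then have "(\<Sum>\<alpha>\<in>Poly_Mapping.keys h. \<bar>Poly_Mapping.lookup h \<alpha>\<bar>) > 0"
      and "(\<Sum>\<alpha>\<in>Poly_Mapping.keys h. (Poly_Mapping.lookup h \<alpha>)\<^sup>2) > 0"
      by (auto simp: in_keys_iff intro!: sum_pos)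
    with assms False show False
      by (auto simp: coeff_norm_def split: if_splits)
  qed
  then show ?thesis
    by simp
qed

text \<open>
  The constant term cancels in the difference; every other monomial vanishes at 0.
\<close>

lemma rpoly_eval_0_diff_le:
  assumes "rdegree e \<le> D"
  shows "rpoly_eval e 0 - rpoly_eval e x \<le>
    (\<Sum>\<alpha>\<in>expos_upto D. \<bar>Poly_Mapping.lookup e \<alpha>\<bar> * \<bar>monom_eval \<alpha> x\<bar>)"
proof -
  have keys: "Poly_Mapping.keys e \<subseteq> expos_upto D"
    using assms by (simp add: keys_subset_expos_upto_iff)
  have "\<bar>monom_eval \<alpha> 0 - monom_eval \<alpha> x\<bar> \<le> \<bar>monom_eval \<alpha> x\<bar>" for \<alpha>
    by (cases "\<alpha> = 0") (auto simp: monom_eval_zero monom_eval_at_0)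
  then have "\<bar>Poly_Mapping.lookup e \<alpha> * (monom_eval \<alpha> 0 - monom_eval \<alpha> x)\<bar> \<le>
      \<bar>Poly_Mapping.lookup e \<alpha>\<bar> * \<bar>monom_eval \<alpha> x\<bar>" for \<alpha>
    unfolding abs_mult by (rule mult_left_mono) simp
  then have "Poly_Mapping.lookup e \<alpha> * (monom_eval \<alpha> 0 - monom_eval \<alpha> x) \<le>
      \<bar>Poly_Mapping.lookup e \<alpha>\<bar> * \<bar>monom_eval \<alpha> x\<bar>" for \<alpha>
    by (rule abs_le_D1)
  then have "(\<Sum>\<alpha>\<in>expos_upto D. Poly_Mapping.lookup e \<alpha> * (monom_eval \<alpha> 0 - monom_eval \<alpha> x)) \<le>
      (\<Sum>\<alpha>\<in>expos_upto D. \<bar>Poly_Mapping.lookup e \<alpha>\<bar> * \<bar>monom_eval \<alpha> x\<bar>)"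
    by (rule sum_mono)
  then show ?thesis
    by (simp add: rpoly_eval_superset[OF card_expos_upto(1) keys] right_diff_distrib sum_subtractf)
qed

text \<open>Hoelder's inequality, in the two pairings of the 1-norm with the maximum norm.\<close>

lemma rpoly_eval_0_diff_le_norm_1:
  assumes "rdegree e \<le> D"
  shows "rpoly_eval e 0 - rpoly_eval e x \<le>
    coeff_norm 1 e * (SUP \<alpha>\<in>expos_upto D. \<bar>monom_eval \<alpha> x\<bar>)"
proof -
  have keys: "Poly_Mapping.keys e \<subseteq> expos_upto D"
    using assms by (simp add: keys_subset_expos_upto_iff)
  have "(\<Sum>\<alpha>\<in>expos_upto D. \<bar>Poly_Mapping.lookup e \<alpha>\<bar> * \<bar>monom_eval \<alpha> x\<bar>) \<le>
      (\<Sum>\<alpha>\<in>expos_upto D. \<bar>Poly_Mapping.lookup e \<alpha>\<bar> * (SUP \<alpha>\<in>expos_upto D. \<bar>monom_eval \<alpha> x\<bar>))"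
    using card_expos_upto(1) by (auto intro!: sum_mono mult_left_mono cSUP_upper bdd_above_finite)
  then show ?thesis
    using rpoly_eval_0_diff_le[OF assms, of x]
    by (simp add: coeff_norm_1_superset[OF card_expos_upto(1) keys] sum_distrib_right)
qed

lemma rpoly_eval_0_diff_le_norm_infinity:
  assumes "rdegree e \<le> D"
  shows "rpoly_eval e 0 - rpoly_eval e x \<le>
    coeff_norm \<infinity> e * (\<Sum>\<alpha>\<in>expos_upto D. \<bar>monom_eval \<alpha> x\<bar>)"
proof -
  have "(\<Sum>\<alpha>\<in>expos_upto D. \<bar>Poly_Mapping.lookup e \<alpha>\<bar> * \<bar>monom_eval \<alpha> x\<bar>) \<le>
      (\<Sum>\<alpha>\<in>expos_upto D. coeff_norm \<infinity> e * \<bar>monom_eval \<alpha> x\<bar>)"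
    by (intro sum_mono mult_right_mono coeff_le_coeff_norm_infinity) auto
  then show ?thesis
    using rpoly_eval_0_diff_le[OF assms, of x] by (simp add: sum_distrib_left)
qed

section \<open>The inverse problem\<close>

text \<open>
  On K every term of the certificate is a sum of squares times a nonnegative constraint value;
  for \<open>j = 0\<close> that value is the constant 1.
\<close>

lemma inv_feasible_minimizer_0:
  assumes "(h, \<sigma>) \<in> inv_feasible f m g d" "x \<in> semialg_set m g"
  shows "rpoly_eval h 0 \<le> rpoly_eval h x"
proof -
  have "rpoly_eval (\<sigma> j) x * rpoly_eval (with_one g j) x \<ge> 0" if "j \<in> {0..m}" for j
  proof (rule mult_nonneg_nonneg)
    show "rpoly_eval (\<sigma> j) x \<ge> 0"
      using assms(1) that by (intro sos_eval_nonneg) (auto simp: inv_feasible_def sos_upto_def)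
    show "rpoly_eval (with_one g j) x \<ge> 0"
      using assms(2) that by (auto simp: semialg_set_def with_one_def rpoly_eval_1)
  qed
  then have "(\<Sum>j=0..m. rpoly_eval (\<sigma> j) x * rpoly_eval (with_one g j) x) \<ge> 0"
    by (rule sum_nonneg)
  moreover have "rpoly_eval h x - rpoly_eval h 0 =
      (\<Sum>j=0..m. rpoly_eval (\<sigma> j) x * rpoly_eval (with_one g j) x)"
    using assms(1) by (simp add: inv_feasible_def)
  ultimately show ?thesis
    by simp
qed

lemma INF_eq_is_arg_min:
  fixes F :: "'a \<Rightarrow> real"
  assumes "is_arg_min F (\<lambda>y. y \<in> A) x"
  shows "(INF y\<in>A. F y) = F x"
  using assms unfolding is_arg_min_linorder
  by (intro cInf_eq_minimum) auto

theorem theorem3p3: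
  fixes f f_d :: "'n::finite rpoly" and g :: "nat \<Rightarrow> 'n rpoly"
    and m d d\<^sub>0 :: nat and k :: enat
    and K :: "(real ^ 'n) set" and x_star :: "real ^ 'n" and f_star :: real
  assumes "d\<^sub>0 = rdegree f"
    and "K = semialg_set m g"
    and "interior K \<noteq> {}"
    and "0 \<in> K"
    and "global_minimizer f K x_star"
    and "f_star = (INF x\<in>K. rpoly_eval f x)"
    and "k \<in> {1, 2, \<infinity>}"
    and "inv_optimal_solution k f m g d f_d"
  shows "(global_minimizer f_d K 0 \<and>
          (inv_value k f m g d = 0 \<longrightarrow> f_d = f \<and> global_minimizer f K 0)) \<and>
         (k = 1 \<longrightarrow>
           (f_star \<le> rpoly_eval f 0 \<and>
            rpoly_eval f 0 \<le> f_star +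
              inv_value 1 f m g d * (SUP \<alpha>\<in>expos_upto d\<^sub>0. \<bar>monom_eval \<alpha> x_star\<bar>)) \<and>
           (K \<subseteq> {x. \<forall>i. x $ i \<in> {-1..1}} \<longrightarrow>
             f_star \<le> rpoly_eval f 0 \<and> rpoly_eval f 0 \<le> f_star + inv_value 1 f m g d)) \<and>
         (k = \<infinity> \<longrightarrow>
           (f_star \<le> rpoly_eval f 0 \<and>
            rpoly_eval f 0 \<le> f_star +
              inv_value \<infinity> f m g d * (\<Sum>\<alpha>\<in>expos_upto d\<^sub>0. \<bar>monom_eval \<alpha> x_star\<bar>)) \<and>
           (K \<subseteq> {x. \<forall>i. x $ i \<in> {-1..1}} \<longrightarrow>
             f_star \<le> rpoly_eval f 0 \<and>
             rpoly_eval f 0 \<le> f_star +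
               real ((CARD('n) + d\<^sub>0) choose CARD('n)) * inv_value \<infinity> f m g d))"
proof -
  obtain \<sigma> where opt: "is_arg_min (inv_objective k f) (\<lambda>p. p \<in> inv_feasible f m g d) (f_d, \<sigma>)"
    using assms(8) by (auto simp: inv_optimal_solution_def)
  then have feas: "(f_d, \<sigma>) \<in> inv_feasible f m g d"
    by (simp add: is_arg_min_def)
  have val: "inv_value k f m g d = coeff_norm k (f - f_d)"
    using INF_eq_is_arg_min[OF opt] by (simp add: inv_value_def inv_objective_def)
  have f_star: "f_star = rpoly_eval f x_star"
    using INF_eq_is_arg_min[OF assms(5)] assms(6) by simp
  have x_star: "x_star \<in> K" and min: "\<And>x. x \<in> K \<Longrightarrow> rpoly_eval f x_star \<le> rpoly_eval f x"
    using assms(5) by (auto simp: is_arg_min_linorder)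
  have min_d: "rpoly_eval f_d 0 \<le> rpoly_eval f_d x" if "x \<in> K" for x
    using inv_feasible_minimizer_0[OF feas] that assms(2) by simp
  then have min_0: "global_minimizer f_d K 0"
    using assms(4) by (simp add: is_arg_min_linorder)
  have zero: "f_d = f" if "inv_value k f m g d = 0"
    using coeff_norm_eq_0D[OF assms(7)] that val by fastforce
  have lower: "f_star \<le> rpoly_eval f 0"
    using min[OF assms(4)] f_star by simp

  have "rdegree f_d \<le> rdegree f"
    using feas by (simp add: inv_feasible_def rpolys_upto_def)
  then have deg: "rdegree (f - f_d) \<le> d\<^sub>0"
    using keys_diff[of f f_d] unfolding assms(1) keys_subset_expos_upto_iff[symmetric]
    using keys_subset_expos_upto_iff[of f "rdegree f"] by auto
  have gap: "rpoly_eval f 0 - f_star \<le> rpoly_eval (f - f_d) 0 - rpoly_eval (f - f_d) x_star"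
    using min_d[OF x_star] f_star by (simp add: rpoly_eval_diff)
  have nonneg: "inv_value k f m g d \<ge> 0"
    using val coeff_norm_nonneg[OF assms(7)] by simp

  have upper_1: "rpoly_eval f 0 \<le> f_star +
      inv_value 1 f m g d * (SUP \<alpha>\<in>expos_upto d\<^sub>0. \<bar>monom_eval \<alpha> x_star\<bar>)" if "k = 1"
    using rpoly_eval_0_diff_le_norm_1[OF deg, of x_star] gap val that by simp
  have upper_infinity: "rpoly_eval f 0 \<le> f_star +
      inv_value \<infinity> f m g d * (\<Sum>\<alpha>\<in>expos_upto d\<^sub>0. \<bar>monom_eval \<alpha> x_star\<bar>)" if "k = \<infinity>"
    using rpoly_eval_0_diff_le_norm_infinity[OF deg, of x_star] gap val that by simp

  have cube: "\<bar>monom_eval \<alpha> x_star\<bar> \<le> 1" if "K \<subseteq> {x. \<forall>i. x $ i \<in> {-1..1}}" for \<alpha>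
    using monom_eval_abs_le_1 that x_star by blast
  have upper_1_cube: "rpoly_eval f 0 \<le> f_star + inv_value 1 f m g d"
    if "k = 1" "K \<subseteq> {x. \<forall>i. x $ i \<in> {-1..1}}"
  proof -
    have "(SUP \<alpha>\<in>expos_upto d\<^sub>0. \<bar>monom_eval \<alpha> x_star\<bar>) \<le> 1"
      using zero_in_expos_upto cube[OF that(2)] by (intro cSUP_least) auto
    then have "inv_value 1 f m g d * (SUP \<alpha>\<in>expos_upto d\<^sub>0. \<bar>monom_eval \<alpha> x_star\<bar>) \<le>
        inv_value 1 f m g d"
      using nonneg that(1) by (intro mult_left_le) auto
    then show ?thesis
      using upper_1[OF that(1)] by linarith
  qed
  have upper_infinity_cube: "rpoly_eval f 0 \<le> f_star +
      real ((CARD('n) + d\<^sub>0) choose CARD('n)) * inv_value \<infinity> f m g d"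
    if "k = \<infinity>" "K \<subseteq> {x. \<forall>i. x $ i \<in> {-1..1}}"
  proof -
    have "(\<Sum>\<alpha>\<in>expos_upto d\<^sub>0. \<bar>monom_eval \<alpha> x_star\<bar>) \<le>
        real (card (expos_upto d\<^sub>0 :: 'n expo set)) * 1"
      using cube[OF that(2)] by (intro sum_bounded_above) auto
    also have "\<dots> \<le> real ((CARD('n) + d\<^sub>0) choose CARD('n))"
      using card_expos_upto(2)[where 'n = 'n] by simp
    finally have "inv_value \<infinity> f m g d * (\<Sum>\<alpha>\<in>expos_upto d\<^sub>0. \<bar>monom_eval \<alpha> x_star\<bar>) \<le>
        inv_value \<infinity> f m g d * real ((CARD('n) + d\<^sub>0) choose CARD('n))"
      using nonneg that(1) by (intro mult_left_mono) auto
    then show ?thesis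
      using upper_infinity[OF that(1)] by (simp add: mult.commute)
  qed
  show ?thesis
    using min_0 zero lower upper_1 upper_infinity upper_1_cube upper_infinity_cube by auto
qed

end
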